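(* Let $q$ be a square, $n\ge 6$, and let $\perp$ be the polarity of $\mathbb{F}_q^n$ associated with a non-degenerate Hermitian form (polar space $U(n,\sqrt q)$). Let $\Gamma$ be the graph whose vertices are the non-isotropic points, two points $x,y$ adjacent iff $x\subseteq y^\perp$. Let $L_1,L_2$ be $2$-dimensional subspaces, not totally isotropic, such that $p:=L_1\cap L_2$ is a point equal to $L_1\cap L_1^\perp$ and to $L_2\cap L_2^\perp$. Let $P=L_1+L_2$ (of dimension $3$) and suppose that $P/p$, with the induced form, is a non-degenerate Hermitian line (isomorphic to $U(2,\sqrt q)$). Let $C_1$ be the set of non-isotropic points of $L_1$ not in $L_2$ and $C_2$ the set of non-isotropic points of $L_2$ not in $L_1$. Then the graph $\overline{\Gamma}$ obtained from $\Gamma$ by switching with respect to $\{C_1,C_2\}$ is not isomorphic to $\Gamma$.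
   Context: Points are $1$-dimensional subspaces; a point $x$ is isotropic if $x\subseteq x^\perp$. $\Gamma(x)$ is the neighbourhood of $x$. For disjoint vertex sets $C_1,C_2$ with $D$ the remaining vertices, the graph $\overline{\Gamma}$ obtained by switching has the same vertices, the same edges inside $C_1\cup C_2$ and inside $D$, and for $x\in D$: $\overline{\Gamma}(x)\cap(C_1\cup C_2)$ equals $C_1$ if $\Gamma(x)\cap(C_1\cup C_2)=C_2$, equals $C_2$ if $\Gamma(x)\cap(C_1\cup C_2)=C_1$, and equals $\Gamma(x)\cap(C_1\cup C_2)$ otherwise. *)

theory Defs
  imports
    "HOL-Analysis.Cartesian_Space"
    "Graph_Theory.Pair_Digraph"
    "Graph_Theory.Digraph_Isomorphism"
begin

section \<open>Hermitian forms on the space of n-tuples over a finite field\<close>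

text \<open>The field has \<open>q = r\<^sup>2\<close> elements; its involution is \<open>c \<mapsto> c ^ r\<close>.\<close>

definition hermitian_form :: "nat \<Rightarrow> ('a::field ^ 'n \<Rightarrow> 'a ^ 'n \<Rightarrow> 'a) \<Rightarrow> bool" where
  "hermitian_form r H \<longleftrightarrow>
     (\<forall>u v w. H (u + v) w = H u w + H v w) \<and>
     (\<forall>u v w. H u (v + w) = H u v + H u w) \<and>
     (\<forall>c u v. H (c *s u) v = c * H u v) \<and>
     (\<forall>c u v. H u (c *s v) = c ^ r * H u v) \<and>
     (\<forall>u v. H v u = (H u v) ^ r)"

lemma hermitian_form_zero_sym:
  assumes "hermitian_form r H" "r > 0" "H u v = 0"
  shows "H v u = 0"
proof -
  have "H v u = H u v ^ r" using assms(1) unfolding hermitian_form_def by blast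
  then show ?thesis using assms(2,3) by simp
qed

definition nondegenerate :: "('a::field ^ 'n \<Rightarrow> 'a ^ 'n \<Rightarrow> 'a) \<Rightarrow> bool" where
  "nondegenerate H \<longleftrightarrow> (\<forall>u. (\<forall>v. H u v = 0) \<longrightarrow> u = 0)"

definition perp :: "('a::field ^ 'n \<Rightarrow> 'a ^ 'n \<Rightarrow> 'a) \<Rightarrow> ('a ^ 'n) set \<Rightarrow> ('a ^ 'n) set" where
  "perp H S = {v. \<forall>s\<in>S. H v s = 0}"

definition is_point :: "('a::field ^ 'n) set \<Rightarrow> bool" where
  "is_point x \<longleftrightarrow> vec.subspace x \<and> vec.dim x = 1"

definition isotropic :: "('a::field ^ 'n \<Rightarrow> 'a ^ 'n \<Rightarrow> 'a) \<Rightarrow> ('a ^ 'n) set \<Rightarrow> bool" where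
  "isotropic H x \<longleftrightarrow> x \<subseteq> perp H x"

definition nonisotropic_points :: "('a::field ^ 'n \<Rightarrow> 'a ^ 'n \<Rightarrow> 'a) \<Rightarrow> ('a ^ 'n) set set" where
  "nonisotropic_points H = {x. is_point x \<and> \<not> isotropic H x}"


section \<open>The induced form on a quotient\<close>

definition quotient_space :: "('a::field ^ 'n) set \<Rightarrow> ('a ^ 'n) set \<Rightarrow> ('a ^ 'n) set set" where
  "quotient_space P p = P // {(u, v). u \<in> P \<and> v \<in> P \<and> u - v \<in> p}"

text \<open>Meaningful only if \<open>p\<close> is contained in the radical of \<open>P\<close>; see \<open>induced_form_eq\<close> below.\<close>

definition induced_form ::
    "('a::field ^ 'n \<Rightarrow> 'a ^ 'n \<Rightarrow> 'a) \<Rightarrow> ('a ^ 'n) set \<Rightarrow> ('a ^ 'n) set \<Rightarrow> 'a" where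
  "induced_form H X Y = (THE c. \<forall>u\<in>X. \<forall>v\<in>Y. H u v = c)"

text \<open>The zero vector of the quotient is the coset \<open>p\<close>.\<close>

definition quotient_nondegenerate ::
    "('a::field ^ 'n \<Rightarrow> 'a ^ 'n \<Rightarrow> 'a) \<Rightarrow> ('a ^ 'n) set \<Rightarrow> ('a ^ 'n) set \<Rightarrow> bool" where
  "quotient_nondegenerate H P p \<longleftrightarrow>
     (\<forall>X \<in> quotient_space P p.
        (\<forall>Y \<in> quotient_space P p. induced_form H X Y = 0) \<longrightarrow> X = p)"

lemma quotient_space_eq:
  assumes "vec.subspace P" "vec.subspace p" "p \<subseteq> P"
  shows "quotient_space P p = (\<lambda>v. (+) v ` p) ` P"
proof -
  have "{(u, v). u \<in> P \<and> v \<in> P \<and> u - v \<in> p} `` {v} = (+) v ` p" if "v \<in> P" for v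
  proof (intro set_eqI iffI)
    fix w assume "w \<in> {(u, v). u \<in> P \<and> v \<in> P \<and> u - v \<in> p} `` {v}"
    then have "v - w \<in> p" by simp
    then have "- (v - w) \<in> p" using assms(2) vec.subspace_neg by blast
    then show "w \<in> (+) v ` p" by (intro image_eqI[of _ _ "w - v"]) auto
  next
    fix w assume "w \<in> (+) v ` p"
    then obtain z where z: "z \<in> p" "w = v + z" by auto
    then have "v + z \<in> P" "- z \<in> p"
      using assms that vec.subspace_add vec.subspace_neg by blast+
    then show "w \<in> {(u, v). u \<in> P \<and> v \<in> P \<and> u - v \<in> p} `` {v}"
      using z that by simp
  qed
  then show ?thesis
    by (auto simp: quotient_space_def quotient_def)
qed

lemma induced_form_eq:
  assumes H: "hermitian_form r H" and r: "r > 0"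
    and p: "vec.subspace p" "p \<subseteq> perp H P" and uv: "u \<in> P" "v \<in> P"
    and P: "vec.subspace P" "p \<subseteq> P"
  shows "induced_form H ((+) u ` p) ((+) v ` p) = H u v"
proof -
  have left: "H s w = 0" if "s \<in> p" "w \<in> P" for s w
    using p(2) that by (auto simp: perp_def)
  have right: "H w s = 0" if "s \<in> p" "w \<in> P" for s w
    using hermitian_form_zero_sym[OF H r] left[OF that] by blast
  have add: "H (x + y) z = H x z + H y z" "H x (y + z) = H x y + H x z" for x y z
    using H unfolding hermitian_form_def by blast+
  have eq: "H (u + s) (v + t) = H u v" if "s \<in> p" "t \<in> p" for s t
  proof -
    have "t \<in> P" using that P(2) by blast
    then show ?thesis using that uv by (simp add: add left right)
  qed
  have "0 \<in> p" using p(1) vec.subspace_0 by blast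
  then have "u \<in> (+) u ` p" "v \<in> (+) v ` p" by force+
  then show ?thesis
    unfolding induced_form_def by (intro the_equality) (auto simp: eq)
qed


section \<open>The graph on the non-isotropic points, and switching\<close>

text \<open>Simple graphs are represented as symmetric loop-free digraphs.\<close>

definition NU_graph :: "('a::field ^ 'n \<Rightarrow> 'a ^ 'n \<Rightarrow> 'a) \<Rightarrow> ('a ^ 'n) set pair_pre_digraph" where
  "NU_graph H =
     \<lparr> pverts = nonisotropic_points H,
       parcs = {(x, y). x \<in> nonisotropic_points H \<and> y \<in> nonisotropic_points H \<and> x \<subseteq> perp H y} \<rparr>"

definition nbhd :: "'v pair_pre_digraph \<Rightarrow> 'v \<Rightarrow> 'v set" where
  "nbhd G x = parcs G `` {x}"

definition switched_nbhd :: "'v pair_pre_digraph \<Rightarrow> 'v set \<Rightarrow> 'v set \<Rightarrow> 'v \<Rightarrow> 'v set" where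
  "switched_nbhd G C1 C2 x =
     (if nbhd G x \<inter> (C1 \<union> C2) = C2 then C1
      else if nbhd G x \<inter> (C1 \<union> C2) = C1 then C2
      else nbhd G x \<inter> (C1 \<union> C2))"

definition switch :: "'v pair_pre_digraph \<Rightarrow> 'v set \<Rightarrow> 'v set \<Rightarrow> 'v pair_pre_digraph" where
  "switch G C1 C2 =
     (let C = C1 \<union> C2; D = pverts G - C in
      \<lparr> pverts = pverts G,
        parcs = parcs G \<inter> (C \<times> C \<union> D \<times> D)
          \<union> {(x, y). x \<in> D \<and> y \<in> switched_nbhd G C1 C2 x}
          \<union> {(y, x). x \<in> D \<and> y \<in> switched_nbhd G C1 C2 x} \<rparr>)"

lemma pair_graph_NU_graph:
  fixes H :: "'a::{field,finite} ^ 'n \<Rightarrow> 'a ^ 'n \<Rightarrow> 'a"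
  assumes H: "hermitian_form r H" and r: "r > 0"
  shows "pair_graph (NU_graph H)"
proof
  have "H v u = 0" if "H u v = 0" for u v
    using hermitian_form_zero_sym[OF H r] that by blast
  then have "y \<subseteq> perp H x" if "x \<subseteq> perp H y" for x y
    using that by (auto simp: perp_def subset_iff)
  then show "symmetric (with_proj (NU_graph H))"
    unfolding symmetric_def by (intro symI) (auto simp: NU_graph_def)
next
  fix e assume "e \<in> parcs (NU_graph H)"
  then show "fst e \<in> pverts (NU_graph H)" "snd e \<in> pverts (NU_graph H)" "fst e \<noteq> snd e"
    by (auto simp: NU_graph_def nonisotropic_points_def isotropic_def)
qed auto

lemma pair_graph_switch:
  assumes G: "pair_graph G" and C: "C1 \<subseteq> pverts G" "C2 \<subseteq> pverts G"
  shows "pair_graph (switch G C1 C2)"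
proof -
  interpret pair_graph G by (rule G)
  have sub: "switched_nbhd G C1 C2 x \<subseteq> C1 \<union> C2" for x
    by (auto simp: switched_nbhd_def)
  have wf: "parcs (switch G C1 C2) \<subseteq> pverts G \<times> pverts G"
    using C sub by (fastforce simp: switch_def Let_def)
  have loop: "fst e \<noteq> snd e" if "e \<in> parcs (switch G C1 C2)" for e
    using that sub pair_no_loops by (fastforce simp: switch_def Let_def)
  have sym: "(y, x) \<in> parcs G" if "(x, y) \<in> parcs G" for x y
    using that pair_sym_arcs by (auto simp: symmetric_def dest: symD)
  have "symmetric (with_proj (switch G C1 C2))"
    unfolding symmetric_def by (intro symI) (auto simp: switch_def Let_def sym)
  moreover have "finite (parcs (switch G C1 C2))"
    using wf finite_subset pair_finite_verts by blast
  moreover have "pverts (switch G C1 C2) = pverts G"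
    by (simp add: switch_def Let_def)
  ultimately show ?thesis
    using wf loop pair_finite_verts by unfold_locales auto
qed

lemma digraph_iso_pair_iff:
  fixes G :: "'v pair_pre_digraph" and G' :: "'w pair_pre_digraph"
  assumes "pair_graph G" "pair_graph G'"
  shows "digraph_iso (with_proj G) (with_proj G') \<longleftrightarrow>
    (\<exists>f. bij_betw f (pverts G) (pverts G') \<and>
      (\<forall>x\<in>pverts G. \<forall>y\<in>pverts G. (x, y) \<in> parcs G \<longleftrightarrow> (f x, f y) \<in> parcs G'))"
    (is "?L \<longleftrightarrow> ?R")
proof -
  interpret G: pair_graph G by (rule assms)
  interpret G': pair_graph G' by (rule assms)
  show ?thesis
  proof
    assume ?L
    then obtain h where h: "G.digraph_isomorphism h" and eq: "with_proj G' = app_iso h (with_proj G)"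
      by (auto simp: digraph_iso_def)
    let ?f = "iso_verts h"
    have verts: "pverts G' = ?f ` pverts G" and arcs: "parcs G' = iso_arcs h ` parcs G"
      and th: "iso_tail h = fst" "iso_head h = snd"
      using eq by (auto simp: with_proj_def app_iso_def)
    have inj: "inj_on ?f (pverts G)"
      using h by (simp add: G.digraph_isomorphism_def)
    have ends: "?f (fst a) = fst (iso_arcs h a)" "?f (snd a) = snd (iso_arcs h a)"
      if "a \<in> parcs G" for a
      using h that th by (auto simp: G.digraph_isomorphism_def)
    have "iso_arcs h a = (?f (fst a), ?f (snd a))" if "a \<in> parcs G" for a
      using ends[OF that] by (simp add: prod_eq_iff)
    then have arcs': "parcs G' = (\<lambda>a. (?f (fst a), ?f (snd a))) ` parcs G"
      using arcs by auto
    have "(x, y) \<in> parcs G \<longleftrightarrow> (?f x, ?f y) \<in> parcs G'"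
      if xy: "x \<in> pverts G" "y \<in> pverts G" for x y
    proof
      assume "(x, y) \<in> parcs G"
      then show "(?f x, ?f y) \<in> parcs G'" unfolding arcs' by force
    next
      assume "(?f x, ?f y) \<in> parcs G'"
      then obtain a where a: "a \<in> parcs G" "?f x = ?f (fst a)" "?f y = ?f (snd a)"
        unfolding arcs' by auto
      then have "x = fst a" "y = snd a"
        using inj xy G.arc_fst_in_verts G.arc_snd_in_verts by (auto dest: inj_onD)
      then show "(x, y) \<in> parcs G" using a by simp
    qed
    then show ?R using verts inj by (auto simp: bij_betw_def)
  next
    assume ?R
    then obtain f where f: "bij_betw f (pverts G) (pverts G')"
      and adj: "\<And>x y. x \<in> pverts G \<Longrightarrow> y \<in> pverts G \<Longrightarrow> (x, y) \<in> parcs G \<longleftrightarrow> (f x, f y) \<in> parcs G'"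
      by blast
    define h where "h = \<lparr> iso_verts = f, iso_arcs = (\<lambda>a. (f (fst a), f (snd a))),
      iso_head = snd, iso_tail = fst \<rparr>"
    have inj: "inj_on f (pverts G)" and im: "f ` pverts G = pverts G'"
      using f by (auto simp: bij_betw_def)
    have "inj_on (\<lambda>a. (f (fst a), f (snd a))) (parcs G)"
    proof (rule inj_onI)
      fix a b assume ab: "a \<in> parcs G" "b \<in> parcs G" "(f (fst a), f (snd a)) = (f (fst b), f (snd b))"
      then have "fst a = fst b" "snd a = snd b"
        using inj_onD[OF inj] G.arc_fst_in_verts G.arc_snd_in_verts by auto
      then show "a = b" by (simp add: prod_eq_iff)
    qed
    then have "G.digraph_isomorphism h"
      using inj G.wf_digraph_axioms by (simp add: G.digraph_isomorphism_def h_def)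
    moreover have "parcs G' = (\<lambda>a. (f (fst a), f (snd a))) ` parcs G"
    proof (intro set_eqI iffI)
      fix a assume a: "a \<in> parcs G'"
      then have "fst a \<in> f ` pverts G" "snd a \<in> f ` pverts G"
        using im G'.arc_fst_in_verts G'.arc_snd_in_verts by auto
      then obtain x y where "x \<in> pverts G" "y \<in> pverts G" "a = (f x, f y)"
        by (metis imageE prod.collapse)
      then show "a \<in> (\<lambda>a. (f (fst a), f (snd a))) ` parcs G"
        using adj a by force
    next
      fix a assume "a \<in> (\<lambda>a. (f (fst a), f (snd a))) ` parcs G"
      then obtain b where "b \<in> parcs G" "a = (f (fst b), f (snd b))" by blast
      then show "a \<in> parcs G'"
        using adj[of "fst b" "snd b"] G.arc_fst_in_verts[of b] G.arc_snd_in_verts[of b] by simp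
    qed
    then have "with_proj G' = app_iso h (with_proj G)"
      using im by (simp add: with_proj_def app_iso_def h_def)
    ultimately show ?L by (auto simp: digraph_iso_def)
  qed
qed

end

theory Submission
  imports Defs "HOL-Computational_Algebra.Polynomial"
begin

text \<open>
  In the graph on the non-isotropic points, two non-adjacent vertices span a line with a third
  non-isotropic point, and everything orthogonal to the first two is orthogonal to the third.
  Switching destroys this. Write \<open>p = \<langle>e\<rangle>\<close>, take \<open>\<langle>u\<rangle>\<close> in \<open>C\<^sub>1\<close> and \<open>\<langle>f + u\<rangle>\<close> with \<open>f\<close>
  an isotropic vector orthogonal to \<open>u\<close> and a complement of \<open>p\<close> in \<open>L\<^sub>2\<close>, not to \<open>e\<close>. Points not orthogonal to \<open>p\<close> keep their
  neighbourhoods, which forces a third vertex onto the line \<open>\<langle>u, f\<rangle>\<close>; a point orthogonal to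
  \<open>L\<^sub>2\<close> and \<open>f + u\<close> but not to \<open>u\<close> becomes a common neighbour of \<open>\<langle>u\<rangle>\<close> and \<open>\<langle>f + u\<rangle>\<close> by
  switching, and on that line it is orthogonal to \<open>\<langle>f + u\<rangle>\<close> only.
\<close>

section \<open>A graph invariant for third points on lines\<close>

text \<open>Membership of \<open>w\<close> in the line through \<open>x\<close> and \<open>y\<close>
  is replaced by a condition on common neighbours, so that isomorphisms preserve the
  property.\<close>

definition third_vertex_property :: "'v pair_pre_digraph \<Rightarrow> bool" where
  "third_vertex_property G \<longleftrightarrow> (\<forall>x\<in>pverts G. \<forall>y\<in>pverts G. x \<noteq> y \<and> (x, y) \<notin> parcs G \<longrightarrow>
     (\<exists>w\<in>pverts G. w \<noteq> x \<and> w \<noteq> y \<and>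
       (\<forall>z\<in>pverts G. (x, z) \<in> parcs G \<and> (y, z) \<in> parcs G \<longrightarrow> (w, z) \<in> parcs G)))"

lemma third_vertex_property_iso:
  assumes iso: "digraph_iso (with_proj G) (with_proj G')"
    and G: "pair_graph G" "pair_graph G'" and third: "third_vertex_property G'"
  shows "third_vertex_property G"
  unfolding third_vertex_property_def
proof (intro ballI impI, elim conjE)
  obtain h where h: "bij_betw h (pverts G) (pverts G')"
    and adj: "\<And>x y. x \<in> pverts G \<Longrightarrow> y \<in> pverts G \<Longrightarrow> (x, y) \<in> parcs G \<longleftrightarrow> (h x, h y) \<in> parcs G'"
    using iso digraph_iso_pair_iff[OF G] by blast
  have hV: "h x \<in> pverts G'" if "x \<in> pverts G" for x using h that by (rule bij_betwE[rule_format])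
  fix x y assume xy: "x \<in> pverts G" "y \<in> pverts G" "x \<noteq> y" "(x, y) \<notin> parcs G"
  then have "h x \<noteq> h y" "(h x, h y) \<notin> parcs G'"
    using h adj[of x y] by (auto simp: bij_betw_def inj_on_eq_iff)
  with third[unfolded third_vertex_property_def, rule_format, OF hV[OF xy(1)] hV[OF xy(2)]]
  obtain w' where w': "w' \<in> pverts G'" "w' \<noteq> h x" "w' \<noteq> h y"
    "\<And>z. z \<in> pverts G' \<Longrightarrow> (h x, z) \<in> parcs G' \<Longrightarrow> (h y, z) \<in> parcs G' \<Longrightarrow> (w', z) \<in> parcs G'"
    by blast
  obtain w where w: "w \<in> pverts G" "w' = h w" using w'(1) h by (auto simp: bij_betw_def)
  have "(w, z) \<in> parcs G" if "z \<in> pverts G" "(x, z) \<in> parcs G" "(y, z) \<in> parcs G" for z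
    using w'(4)[OF hV[OF that(1)]] that adj[OF xy(1) that(1)] adj[OF xy(2) that(1)]
      adj[OF w(1) that(1)] w(2) by simp
  moreover have "w \<noteq> x" "w \<noteq> y" using w w' by auto
  ultimately show "\<exists>w\<in>pverts G. w \<noteq> x \<and> w \<noteq> y \<and>
       (\<forall>z\<in>pverts G. (x, z) \<in> parcs G \<and> (y, z) \<in> parcs G \<longrightarrow> (w, z) \<in> parcs G)"
    using w(1) by blast
qed

section \<open>Adjacency in the switched graph\<close>

lemma switch_arc_outside:
  assumes "w \<in> pverts G - (C1 \<union> C2)" "z \<in> pverts G - (C1 \<union> C2)"
  shows "(w, z) \<in> parcs (switch G C1 C2) \<longleftrightarrow> (w, z) \<in> parcs G"
proof -
  have "switched_nbhd G C1 C2 x \<subseteq> C1 \<union> C2" for x by (auto simp: switched_nbhd_def)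
  then show ?thesis using assms unfolding switch_def Let_def by auto
qed

lemma switch_arc_switched:
  assumes "z \<in> pverts G - (C1 \<union> C2)" "nbhd G z \<inter> (C1 \<union> C2) = C2" "x \<in> C1"
  shows "(x, z) \<in> parcs (switch G C1 C2)"
proof -
  have "x \<in> switched_nbhd G C1 C2 z" using assms by (simp add: switched_nbhd_def)
  then show ?thesis using assms(1) by (simp add: switch_def Let_def)
qed

text \<open>For \<open>w\<close> in \<open>C1 \<union> C2\<close> the last branch of
  \<open>switched_nbhd\<close> applies, read from the side of \<open>z\<close> by symmetry of
  \<open>G\<close>; for other \<open>w\<close> both ends lie outside
  \<open>C1 \<union> C2\<close>.\<close>

lemma switch_arc_unchanged:
  assumes G: "pair_graph G" and z: "z \<in> pverts G - (C1 \<union> C2)"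
    and "nbhd G z \<inter> (C1 \<union> C2) \<noteq> C1" "nbhd G z \<inter> (C1 \<union> C2) \<noteq> C2" and w: "w \<in> pverts G"
  shows "(w, z) \<in> parcs (switch G C1 C2) \<longleftrightarrow> (w, z) \<in> parcs G"
proof (cases "w \<in> C1 \<union> C2")
  case True
  interpret pair_graph G by (rule G)
  have "(w, z) \<in> parcs G \<longleftrightarrow> (z, w) \<in> parcs G"
    using pair_sym_arcs by (auto simp: symmetric_def dest: symD)
  moreover have "switched_nbhd G C1 C2 z = nbhd G z \<inter> (C1 \<union> C2)"
    using assms by (simp add: switched_nbhd_def)
  ultimately show ?thesis
    using True z by (auto simp: switch_def Let_def nbhd_def)
next
  case False
  then show ?thesis using switch_arc_outside[OF _ z] w by simp
qed

section \<open>Points and lines as spans\<close>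

lemma span_pair:
  fixes x y :: "'a::field ^ 'n"
  shows "vec.span {x, y} = {a *s x + b *s y | a b. True}"
proof -
  have "z \<in> vec.span {x, y} \<longleftrightarrow> (\<exists>a b. z = a *s x + b *s y)" for z
    by (simp add: vec.span_breakdown_eq[of z x] vec.span_singleton image_iff diff_eq_eq add.commute)
  then show ?thesis by auto
qed

lemma span_singleton_subset:
  assumes "vec.subspace L"
  shows "vec.span {v} \<subseteq> L \<longleftrightarrow> v \<in> L"
  using assms vec.span_minimal[of "{v}" L] vec.span_base[of v "{v}"] by auto

lemma span_singleton_eq:
  assumes "v \<in> vec.span {w}" "v \<noteq> 0"
  shows "vec.span {v} = vec.span {w}"
proof -
  obtain c where c: "v = c *s w" using assms(1) by (auto simp: vec.span_singleton)
  then have "c \<noteq> 0" using assms(2) by auto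
  then have "w = inverse c *s v" using c by simp
  then have "w \<in> vec.span {v}" by (metis vec.span_scale vec.span_base singletonI)
  then show ?thesis using assms(1) by (simp add: subset_antisym span_singleton_subset)
qed

lemma is_point_iff: "is_point x \<longleftrightarrow> (\<exists>v. v \<noteq> 0 \<and> x = vec.span {v})"
proof
  assume "is_point x"
  then have x: "vec.subspace x" "vec.dim x = 1" by (auto simp: is_point_def)
  obtain B where B: "B \<subseteq> x" "vec.independent B" "x \<subseteq> vec.span B" "card B = vec.dim x"
    by (rule vec.basis_exists)
  then obtain v where v: "B = {v}" using x by (auto simp: card_1_singleton_iff)
  then have "v \<noteq> 0" using B by (simp add: vec.dependent_single)
  moreover have "x = vec.span {v}" using B v x vec.span_minimal[of B x] by auto
  ultimately show "\<exists>v. v \<noteq> 0 \<and> x = vec.span {v}" by blast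
next
  assume "\<exists>v. v \<noteq> 0 \<and> x = vec.span {v}"
  then obtain v where v: "v \<noteq> 0" "x = vec.span {v}" by blast
  then have "vec.independent {v}" by (simp add: vec.dependent_single)
  then show "is_point x"
    using v vec.dim_span_eq_card_independent[of "{v}"] by (simp add: is_point_def)
qed

section \<open>The involution of the field and its trace\<close>

locale hermitian_space =
  fixes H :: "'a::{field,finite} ^ 'n \<Rightarrow> 'a ^ 'n \<Rightarrow> 'a" and r :: nat
  assumes card_field: "CARD('a) = r\<^sup>2"
    and form: "hermitian_form r H" and nondeg: "nondegenerate H"
begin

lemma r_ge_2: "r \<ge> 2"
proof (rule ccontr)
  assume "\<not> r \<ge> 2"
  then have "r = 0 \<or> r = 1" by auto
  then have "CARD('a) \<le> 1" using card_field by auto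
  moreover have "card {0, 1 :: 'a} \<le> CARD('a)" by (rule card_mono) auto
  ultimately show False by simp
qed

lemma add_left [simp]: "H (u + v) w = H u w + H v w"
  and add_right [simp]: "H u (v + w) = H u v + H u w"
  and scale_left [simp]: "H (c *s u) v = c * H u v"
  and scale_right [simp]: "H u (c *s v) = c ^ r * H u v"
  and conj_sym: "H v u = (H u v) ^ r"
  using form unfolding hermitian_form_def by blast+

lemma conj_zero [simp]: "(0 :: 'a) ^ r = 0"
  using r_ge_2 by simp

lemma zero_left [simp]: "H 0 v = 0" and zero_right [simp]: "H v 0 = 0"
  using scale_left[of 0 0 v] scale_right[of v 0 0] by auto

lemma minus_left [simp]: "H (- u) v = - H u v" and minus_right [simp]: "H v (- u) = - H v u"
  using add_left[of u "- u" v] add_right[of v u "- u"] by (auto simp: eq_neg_iff_add_eq_0 add.commute)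

lemma diff_left [simp]: "H (u - v) w = H u w - H v w"
  and diff_right [simp]: "H w (u - v) = H w u - H w v"
  using add_left[of u "- v" w] add_right[of w u "- v"] by simp_all

lemma orth_sym: "H u v = 0 \<Longrightarrow> H v u = 0"
  using conj_sym[of v u] r_ge_2 by simp

text \<open>Nondegeneracy of \<open>H\<close> enters the later arguments only through this vector,
  scaled in the linear first argument.\<close>

lemma exists_dual:
  assumes "w \<noteq> 0"
  obtains t where "H t w = 1"
proof -
  obtain v where "H w v \<noteq> 0" using assms nondeg unfolding nondegenerate_def by blast
  then have "H v w \<noteq> 0" using orth_sym by blast
  then have "H (inverse (H v w) *s v) w = 1" by simp
  then show ?thesis using that by blast
qed

text \<open>The laws of the involution are read off from the form: when \<open>H t 1 = 1\<close>,
  the value \<open>H 1 (c *s t)\<close> is \<open>c ^ r\<close>, so additivity in the second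
  argument gives the first law and applying \<open>conj_sym\<close> twice the second.\<close>

lemma conj_add [simp]: "(a + b) ^ r = a ^ r + (b :: 'a) ^ r"
  and conj_conj [simp]: "((a :: 'a) ^ r) ^ r = a"
proof -
  \<comment> \<open>The all-ones vector serves as some nonzero vector.\<close>
  have "(1 :: 'a ^ 'n) \<noteq> 0" by simp
  then obtain t where t: "H t (1 :: 'a ^ 'n) = 1" by (rule exists_dual)
  have c: "H 1 (c *s t) = c ^ r" for c using conj_sym[of 1 "c *s t"] t by simp
  have "(a + b) *s t = a *s t + b *s t" by (rule vec.scale_left_distrib)
  then show "(a + b) ^ r = a ^ r + b ^ r" using c[of "a + b"] c[of a] c[of b] add_right by metis
  show "(a ^ r) ^ r = a" using conj_sym[of "a *s t" 1] c[of a] t by (metis mult.right_neutral scale_left)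
qed

lemma conj_minus [simp]: "(- a :: 'a) ^ r = - (a ^ r)"
  using conj_add[of a "- a"] by (simp add: eq_neg_iff_add_eq_0 add.commute del: conj_add)

lemma conj_norm [simp]: "H v v ^ r = H v v"
  using conj_sym[of v v] by simp

text \<open>The polynomial \<open>X + X ^ r\<close> is nonzero of degree at most \<open>r\<close>,
  so it cannot vanish at all \<open>r\<^sup>2\<close> scalars.\<close>

lemma trace_nonzero:
  obtains c :: 'a where "c + c ^ r \<noteq> 0"
proof (rule ccontr)
  assume "\<not> thesis"
  then have z: "c + c ^ r = 0" for c :: 'a using that by blast
  define g :: "'a poly" where "g = monom 1 1 + monom 1 r"
  have "coeff g 1 = 1" using r_ge_2 by (simp add: g_def)
  then have g0: "g \<noteq> 0" by auto
  have "poly g c = 0" for c using z[of c] by (simp add: g_def poly_monom)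
  then have "{c. poly g c = 0} = UNIV" by auto
  then have "CARD('a) \<le> degree g" using card_poly_roots_bound[OF g0] by simp
  also have "\<dots> \<le> r" unfolding g_def
    using r_ge_2 by (intro degree_add_le order.trans[OF degree_monom_le]) auto
  finally have "r * r \<le> r * 1" using card_field by (simp add: power2_eq_square)
  then show False using r_ge_2 by simp
qed

text \<open>The trace \<open>c + c ^ r\<close> is linear over the scalars fixed by the involution,
  so a scalar \<open>b\<close> of nonzero trace \<open>t\<close> can be rescaled by
  \<open>h / t\<close>.\<close>

lemma trace_onto:
  fixes h :: 'a
  assumes "h ^ r = h"
  obtains c where "c + c ^ r = h"
proof -
  obtain b :: 'a where b: "b + b ^ r \<noteq> 0" by (rule trace_nonzero)
  define t where "t = b + b ^ r"
  have "t ^ r = t" by (simp add: t_def add.commute)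
  then have "(h * b / t) ^ r = h * b ^ r / t" using assms by (simp add: power_mult_distrib power_divide)
  then have "h * b / t + (h * b / t) ^ r = h * t / t" by (simp add: t_def add_divide_distrib distrib_left)
  then have "h * b / t + (h * b / t) ^ r = h" using b by (simp add: t_def)
  then show ?thesis using that by blast
qed

section \<open>Norms on lines and hyperbolic pairs\<close>

text \<open>The norm of \<open>u + c *s v\<close> is a polynomial in \<open>c\<close> of degree at
  most \<open>r + 1\<close>, and failure would give it \<open>r\<^sup>2 - 1\<close> nonzero roots.
  That is too many for \<open>r \<ge> 3\<close>; for \<open>r = 2\<close> the two numbers
  coincide.\<close>

lemma third_point_on_line:
  assumes u: "H u u \<noteq> 0" and uv: "H u v \<noteq> 0"
  obtains c where "c \<noteq> 0" "H (u + c *s v) (u + c *s v) \<noteq> 0"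
proof (rule ccontr)
  assume "\<not> thesis"
  then have z: "\<And>c. c \<noteq> 0 \<Longrightarrow> H (u + c *s v) (u + c *s v) = 0" using that by blast
  have z': "H u u + c * H v u + c ^ r * H u v + c ^ (r + 1) * H v v = 0" if "c \<noteq> 0" for c
    using z[OF that] by (simp add: algebra_simps)
  have contra: "r\<^sup>2 - 1 \<le> degree g" if "g \<noteq> 0" "\<And>c. c \<noteq> 0 \<Longrightarrow> poly g c = 0" for g :: "'a poly"
  proof -
    have "card (UNIV - {0 :: 'a}) \<le> card {c. poly g c = 0}"
      using that by (intro card_mono) (auto intro: poly_roots_finite)
    then show ?thesis using card_poly_roots_bound[OF that(1)] card_field by (simp add: card_Diff_singleton)
  qed
  show False
  proof (cases "r = 2")
    case True
    \<comment> \<open>All three nonzero scalars may be roots of a cubic, but on them \<open>c ^ 3 = 1\<close> lowers the degree.\<close>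
    have cube: "c ^ 3 = 1" if "c \<noteq> 0" for c :: 'a
    proof -
      have "c ^ 3 * c = 1 * c" using conj_conj[of c] True by (simp add: power_mult[symmetric] eval_nat_numeral ac_simps)
      then show ?thesis using that by simp
    qed
    define g where "g = [:H u u + H v v, H v u, H u v:]"
    have "poly g c = 0" if "c \<noteq> 0" for c
    proof -
      have "H u u + c * H v u + c\<^sup>2 * H u v + 1 * H v v = 0"
        using z'[OF that] cube[OF that] True by simp
      then show ?thesis by (simp add: g_def algebra_simps power2_eq_square)
    qed
    \<comment> \<open>The leading coefficient \<open>H u v\<close> makes \<open>g\<close> nonzero,
      while its degree is at most 2.\<close>
    then have "3 \<le> degree g" using contra[of g] uv True by (simp add: g_def)
    then show False by (simp add: g_def split: if_splits)
  next
    case False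
    then have r: "r \<ge> 3" using r_ge_2 by simp
    define g where "g = [:H u u:] + monom (H v u) 1 + monom (H u v) r + monom (H v v) (r + 1)"
    have "coeff g 0 = H u u" using r by (simp add: g_def)
    then have "g \<noteq> 0" using u by auto
    moreover have "poly g c = 0" if "c \<noteq> 0" for c
      using z'[OF that] by (simp add: g_def poly_monom ac_simps)
    ultimately have "r\<^sup>2 - 1 \<le> degree g" by (rule contra)
    also have "\<dots> \<le> r + 1" unfolding g_def
      by (intro degree_add_le order.trans[OF degree_monom_le]) auto
    finally have "r * r \<le> r + 2" by (simp add: power2_eq_square)
    moreover have "3 * r \<le> r * r" using r by simp
    ultimately show False using r by linarith
  qed
qed

text \<open>A vector with product 1 with \<open>e\<close> is projected off \<open>u\<close> and
  \<open>v\<close>; adding a multiple of \<open>e\<close> then corrects its norm without changing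
  the other products.\<close>

lemma hyperbolic_partner:
  assumes e: "e \<noteq> 0" "H e e = 0" "H e u = 0" "H e v = 0"
    and uv: "H u v = 0" "H u u \<noteq> 0" "H v v \<noteq> 0"
  obtains f where "H f f = 0" "H e f = 1" "H f u = 0" "H f v = 0"
proof -
  obtain t where t: "H t e = 1" using e(1) by (rule exists_dual)
  define g where "g = t - (H t u / H u u) *s u - (H t v / H v v) *s v"
  have s: "H v u = 0" "H u e = 0" "H v e = 0" using uv e orth_sym by blast+
  have g: "H g e = 1" "H g u = 0" "H g v = 0"
    using t uv s by (auto simp: g_def)
  have eg: "H e g = 1" using conj_sym[of e g] g by simp
  \<comment> \<open>Adding \<open>c *s e\<close> to \<open>g\<close> changes the norm by the trace
    of \<open>c\<close>, and every fixed scalar is a trace.\<close>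
  have "(- H g g) ^ r = - H g g" by simp
  then obtain c where c: "c + c ^ r = - H g g" by (rule trace_onto)
  have "H (g + c *s e) (g + c *s e) = H g g + (c + c ^ r)"
    using g eg e by (simp add: algebra_simps)
  then have "H (g + c *s e) (g + c *s e) = 0" using c by simp
  moreover have "H e (g + c *s e) = 1" "H (g + c *s e) u = 0" "H (g + c *s e) v = 0"
    using g eg e by auto
  ultimately show ?thesis using that by blast
qed

text \<open>If \<open>t\<close> is isotropic, adding \<open>c *s k\<close> gives it the norm
  \<open>c + c ^ r\<close>, which is nonzero for a suitable \<open>c\<close>.\<close>

lemma nonisotropic_not_orthogonal:
  assumes k: "H k k = 0" and t: "H t k = 1"
  obtains c where "H (t + c *s k) (t + c *s k) \<noteq> 0"
proof (cases "H t t = 0")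
  case False
  then show ?thesis using that[of 0] by simp
next
  case True
  obtain c :: 'a where c: "c + c ^ r \<noteq> 0" by (rule trace_nonzero)
  have "H k t = 1" using conj_sym[of k t] t by simp
  then have "H (t + c *s k) (t + c *s k) = c + c ^ r" using k t True by (simp add: algebra_simps)
  then show ?thesis using c that by metis
qed

section \<open>Vectors orthogonal to a hyperbolic pair\<close>

text \<open>Only test vectors not orthogonal to \<open>e\<close> are available, because switching
  leaves their neighbourhoods alone. Comparing several of them shows that \<open>w\<close> has no
  component orthogonal to \<open>e\<close>, \<open>f\<close>, \<open>u\<close>; the vector
  \<open>v\<close> then gives \<open>H w f = 0\<close>, which removes the coefficient of
  \<open>e\<close>.\<close>

lemma in_line_if_orthogonal:
  assumes ef: "H e e = 0" "H f f = 0" "H e f = 1"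
    and u: "H u u \<noteq> 0" "H e u = 0" "H f u = 0"
    and v: "H v v \<noteq> 0" "H v e = 0" "H v f = 0" "H v u = 0"
    and w: "\<And>z. H z z \<noteq> 0 \<Longrightarrow> H z e \<noteq> 0 \<Longrightarrow> H z u = 0 \<Longrightarrow> H z f = 0 \<Longrightarrow> H w z = 0"
  obtains b c where "w = b *s f + c *s u"
proof -
  have s: "H f e = 1" "H u e = 0" "H u f = 0"
    using conj_sym[of f e] ef u(2,3)[THEN orth_sym] by simp_all
  have wf: "H w m = 0 \<and> H w f = 0"
    if m: "H m m \<noteq> 0" "H m e = 0" "H m f = 0" "H m u = 0" for m
  proof -
    have fm: "H f m = 0" using orth_sym m by blast
    \<comment> \<open>The test vector \<open>f + c *s m\<close> has product 1 with \<open>e\<close>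
      and norm \<open>c ^ (r + 1) * H m m\<close>. Two values of \<open>c\<close> with different
      \<open>c ^ r\<close> separate the two summands.\<close>
    have fcm: "H w f + c ^ r * H w m = 0" if "c \<noteq> 0" for c
      using w[of "f + c *s m"] that m fm ef u s by (simp add: algebra_simps)
    have "card {0, 1 :: 'a} < CARD('a)"
    proof -
      have "2 * 2 \<le> r * r" using r_ge_2 by (intro mult_le_mono) auto
      then show ?thesis using card_field by (simp add: power2_eq_square)
    qed
    then have "UNIV \<noteq> {0, 1 :: 'a}" by (metis less_irrefl)
    then obtain c :: 'a where c: "c \<noteq> 0" "c \<noteq> 1" by blast
    have "c ^ r \<noteq> 1" using conj_conj[of c] c by (metis power_one)
    moreover have "(c ^ r - 1) * H w m = 0"
    proof -
      have "(c ^ r - 1) * H w m = (H w f + c ^ r * H w m) - (H w f + 1 ^ r * H w m)"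
        by (simp add: left_diff_distrib)
      also have "\<dots> = 0" using fcm[of c] fcm[of 1] c by simp
      finally show ?thesis .
    qed
    ultimately have "H w m = 0" by simp
    then show ?thesis using fcm[of 1] by simp
  qed
  \<comment> \<open>This is the component of \<open>w\<close> orthogonal to the hyperbolic pair and
    to \<open>u\<close>.\<close>
  define k where "k = w - H w f *s e - H w e *s f - (H w u / H u u) *s u"
  have k: "H k e = 0" "H k f = 0" "H k u = 0"
    using ef u s by (auto simp: k_def)
  have km: "H k m = H w m" if "H m e = 0" "H m f = 0" "H m u = 0" for m
    using orth_sym[OF that(1)] orth_sym[OF that(2)] orth_sym[OF that(3)] by (simp add: k_def)
  have "k = 0"
  proof (rule ccontr)
    assume "k \<noteq> 0"
    then obtain t where t: "H t k = 1" by (rule exists_dual)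
    \<comment> \<open>Otherwise \<open>k\<close> itself would be admissible as \<open>m\<close>,
      forcing \<open>H k k = H w k = 0\<close>.\<close>
    have kk: "H k k = 0" using wf[of k] km[of k] k by auto
    define t' where "t' = t - H t f *s e - H t e *s f - (H t u / H u u) *s u"
    have t': "H t' e = 0" "H t' f = 0" "H t' u = 0" "H t' k = 1"
      using ef u s t orth_sym[OF k(1)] orth_sym[OF k(2)] orth_sym[OF k(3)] by (auto simp: t'_def)
    obtain c where c: "H (t' + c *s k) (t' + c *s k) \<noteq> 0"
      using nonisotropic_not_orthogonal[OF kk t'(4)] by blast
    have "H k (t' + c *s k) = 0"
      using wf[OF c] km[of "t' + c *s k"] t' k by simp
    then show False using orth_sym[of k "t' + c *s k"] t' kk by simp
  qed
  moreover have "H w f = 0" using wf[of v] v by simp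
  ultimately have "w = H w e *s f + (H w u / H u u) *s u"
    by (simp add: k_def algebra_simps)
  then show ?thesis using that by blast
qed

text \<open>The orthogonal complement of \<open>e\<close>, \<open>f\<close>, \<open>u\<close>,
  \<open>v\<close> is nondegenerate and has dimension at least 2. A constant norm \<open>k\<close>
  on its nonzero vectors cannot be 0, and for \<open>k \<noteq> 0\<close> two orthogonal vectors of
  norm \<open>k\<close> have a sum of norm \<open>k + k\<close>.\<close>

lemma orthogonal_vector_norm_avoids:
  assumes n: "CARD('n) \<ge> 6"
    and ef: "H e e = 0" "H f f = 0" "H e f = 1"
    and u: "H u u \<noteq> 0" "H u e = 0" "H u f = 0"
    and v: "H v v \<noteq> 0" "H v e = 0" "H v f = 0" "H v u = 0"
  obtains x where "x \<noteq> 0" "H x e = 0" "H x f = 0" "H x u = 0" "H x v = 0" "H x x \<noteq> k"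
proof (rule ccontr)
  assume "\<not> thesis"
  then have all: "\<And>x. \<lbrakk>x \<noteq> 0; H x e = 0; H x f = 0; H x u = 0; H x v = 0\<rbrakk> \<Longrightarrow> H x x = k"
    using that by blast
  have s: "H f e = 1" "H e u = 0" "H f u = 0" "H e v = 0" "H f v = 0" "H u v = 0"
    using conj_sym[of f e] ef v(2-4)[THEN orth_sym] u(2,3)[THEN orth_sym] by simp_all
  \<comment> \<open>The orthogonal projection onto the complement.\<close>
  define \<pi> where "\<pi> x = x - H x f *s e - H x e *s f - (H x u / H u u) *s u - (H x v / H v v) *s v" for x
  have \<pi>: "H (\<pi> x) e = 0" "H (\<pi> x) f = 0" "H (\<pi> x) u = 0" "H (\<pi> x) v = 0" for x
    using ef u v s by (auto simp: \<pi>_def)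
  have \<pi>H: "H (\<pi> t) x = H t x"
    if "H x e = 0" "H x f = 0" "H x u = 0" "H x v = 0" for t x
    using that[THEN orth_sym] by (simp add: \<pi>_def)
  have outside: "\<exists>x. x \<notin> vec.span {e, f, u, v, y}" for y
  proof (rule ccontr)
    assume "\<nexists>x. x \<notin> vec.span {e, f, u, v, y}"
    then have "vec.dim (UNIV :: ('a ^ 'n) set) \<le> card {e, f, u, v, y}"
      by (intro vec.dim_le_card) auto
    also have "\<dots> \<le> 5" by (intro card_insert_le_m1) auto
    finally show False using n by (simp only: vec_dim_card)
  qed
  have \<pi>_in: "x \<in> vec.span {e, f, u, v, y}" if "\<pi> x \<in> vec.span {e, f, u, v, y}" for x y
  proof -
    have "x = \<pi> x + (H x v / H v v) *s v + (H x u / H u u) *s u + H x e *s f + H x f *s e"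
      by (simp only: \<pi>_def diff_add_cancel)
    moreover have "\<dots> \<in> vec.span {e, f, u, v, y}"
      by (intro vec.span_add vec.span_scale vec.span_base that) auto
    ultimately show ?thesis by simp
  qed
  \<comment> \<open>The second \<open>e\<close> only fills the fifth slot; in the next line that
    slot holds \<open>\<pi> a\<close>, which makes the two projections independent.\<close>
  obtain a where a: "a \<notin> vec.span {e, f, u, v, e}" using outside by blast
  obtain b where b: "b \<notin> vec.span {e, f, u, v, \<pi> a}" using outside by blast
  have a0: "\<pi> a \<noteq> 0" using \<pi>_in[of a e] a vec.span_zero by metis
  have b0: "\<pi> b + c *s \<pi> a \<noteq> 0" for c
  proof
    assume "\<pi> b + c *s \<pi> a = 0"
    then have "\<pi> b = (- c) *s \<pi> a" by (simp add: eq_neg_iff_add_eq_0)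
    moreover have "\<dots> \<in> vec.span {e, f, u, v, \<pi> a}"
      by (intro vec.span_scale vec.span_base) auto
    ultimately show False using \<pi>_in b by metis
  qed
  have aa: "H (\<pi> a) (\<pi> a) = k" using all a0 \<pi> by blast
  show False
  proof (cases "k = 0")
    case True
    obtain t where t: "H t (\<pi> a) = 1" using a0 by (rule exists_dual)
    have "H (\<pi> t) (\<pi> a) = 1" using \<pi>H \<pi> t by simp
    then obtain c where c: "H (\<pi> t + c *s \<pi> a) (\<pi> t + c *s \<pi> a) \<noteq> 0"
      using nonisotropic_not_orthogonal aa True by metis
    moreover from c have "\<pi> t + c *s \<pi> a \<noteq> 0" by (metis zero_left)
    ultimately show False using all[of "\<pi> t + c *s \<pi> a"] True \<pi> by simp
  next
    case False
    \<comment> \<open>Gram-Schmidt: \<open>y\<close> is the part of \<open>\<pi> b\<close>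
      orthogonal to \<open>\<pi> a\<close>.\<close>
    define y where "y = \<pi> b + (- H (\<pi> b) (\<pi> a) / k) *s \<pi> a"
    have ya: "H y (\<pi> a) = 0" using aa False by (simp add: y_def)
    have ay: "H (\<pi> a) y = 0" using ya by (rule orth_sym)
    have yp: "H y e = 0" "H y f = 0" "H y u = 0" "H y v = 0" using \<pi> by (auto simp: y_def)
    have "y \<noteq> 0" unfolding y_def by (rule b0)
    then have yy: "H y y = k" using all yp by blast
    have "y + \<pi> a = \<pi> b + (- H (\<pi> b) (\<pi> a) / k + 1) *s \<pi> a"
      unfolding y_def by (simp only: vec.scale_left_distrib vec.scale_one add.assoc)
    then have "y + \<pi> a \<noteq> 0" using b0 by metis
    then have "H (y + \<pi> a) (y + \<pi> a) = k" using all[of "y + \<pi> a"] yp \<pi> by simp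
    then have "k + k = k" using yy aa ay ya by (simp only: add_left add_right add_0_left add_0_right)
    then show False using False by (metis add_cancel_right_right)
  qed
qed

text \<open>In \<open>z = u - H u u *s e + b *s v + x\<close> the multiple of \<open>e\<close>
  cancels the product with \<open>f + u\<close>, and \<open>b\<close> cancels the product with
  \<open>a *s u + v\<close>. The extra \<open>x\<close> keeps \<open>z\<close> off the line of
  \<open>e\<close> and \<open>u\<close>, and its norm is chosen so that \<open>z\<close> is not
  isotropic.\<close>

lemma switched_witness:
  assumes n: "CARD('n) \<ge> 6"
    and ef: "H e e = 0" "H f f = 0" "H e f = 1"
    and u: "H u u \<noteq> 0" "H u e = 0" "H u f = 0"
    and v: "H v v \<noteq> 0" "H v e = 0" "H v f = 0" "H v u = 0"
  obtains z where "H z z \<noteq> 0" "H z e = 0" "H z (a *s u + v) = 0" "H z (f + u) = 0"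
    "H z u \<noteq> 0" "z \<notin> vec.span {e, u}"
proof -
  have s: "H f e = 1" "H e u = 0" "H f u = 0" "H e v = 0" "H f v = 0" "H u v = 0"
    using conj_sym[of f e] ef v(2-4)[THEN orth_sym] u(2,3)[THEN orth_sym] by simp_all
  define b where "b = - (a ^ r * H u u) / H v v"
  obtain x where x: "x \<noteq> 0" "H x e = 0" "H x f = 0" "H x u = 0" "H x v = 0"
    "H x x \<noteq> - (H u u + b * b ^ r * H v v)"
    using orthogonal_vector_norm_avoids[OF n ef u v] by blast
  note x' = x(2-5)[THEN orth_sym]
  define z where "z = u - H u u *s e + b *s v + x"
  have "H z z = H u u + b * b ^ r * H v v + H x x"
    using ef u v s x x' by (simp add: z_def algebra_simps)
  then have 1: "H z z \<noteq> 0" using x(6) by (simp only: add_eq_0_iff) simp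
  have 2: "H z e = 0" "H z (f + u) = 0" "H z u \<noteq> 0"
    using ef u v s x x' by (simp_all add: z_def algebra_simps)
  have 3: "H z (a *s u + v) = 0"
    using ef u v s x x' by (simp add: z_def b_def algebra_simps)
  have "z \<notin> vec.span {e, u}"
  proof
    assume "z \<in> vec.span {e, u}"
    then obtain c d where "z - c *s e = d *s u"
      by (auto simp: vec.span_breakdown_eq)
    then have "z = c *s e + d *s u" by (simp add: diff_eq_eq add.commute)
    then have xeq: "x = (c + H u u) *s e + (d - 1) *s u - b *s v"
      by (simp add: z_def algebra_simps)
    have "H x f = c + H u u" "H x u = (d - 1) * H u u" "H x v = - b * H v v"
      using ef u v s by (simp_all add: xeq)
    then have "c + H u u = 0" "d - 1 = 0" "b = 0" using x u v by auto
    then have "x = 0" by (subst xeq) simp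
    then show False using x(1) by simp
  qed
  then show ?thesis using that 1 2 3 by blast
qed

section \<open>The graph before and after switching\<close>

lemma span_subset_perp: "vec.span {u} \<subseteq> perp H (vec.span {v}) \<longleftrightarrow> H u v = 0"
proof
  assume "vec.span {u} \<subseteq> perp H (vec.span {v})"
  then show "H u v = 0" using vec.span_base[of u "{u}"] vec.span_base[of v "{v}"] by (auto simp: perp_def)
qed (auto simp: perp_def vec.span_singleton)

lemma nonisotropic_points_iff:
  "x \<in> nonisotropic_points H \<longleftrightarrow> (\<exists>v. H v v \<noteq> 0 \<and> x = vec.span {v})"
proof
  assume "x \<in> nonisotropic_points H"
  then have "is_point x" and n: "\<not> isotropic H x" by (auto simp: nonisotropic_points_def)
  then obtain v where "x = vec.span {v}" by (auto simp: is_point_iff)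
  then show "\<exists>v. H v v \<noteq> 0 \<and> x = vec.span {v}"
    using n by (auto simp: isotropic_def span_subset_perp)
next
  assume "\<exists>v. H v v \<noteq> 0 \<and> x = vec.span {v}"
  then obtain v where v: "H v v \<noteq> 0" "x = vec.span {v}" by blast
  then have "v \<noteq> 0" by auto
  then show "x \<in> nonisotropic_points H"
    using v by (auto simp: nonisotropic_points_def is_point_iff isotropic_def span_subset_perp)
qed

lemma NU_graph_arc_iff:
  assumes "H u u \<noteq> 0" "H v v \<noteq> 0"
  shows "(vec.span {u}, vec.span {v}) \<in> parcs (NU_graph H) \<longleftrightarrow> H u v = 0"
proof -
  have "vec.span {u} \<in> nonisotropic_points H" "vec.span {v} \<in> nonisotropic_points H"
    using assms unfolding nonisotropic_points_iff by blast+
  then show ?thesis by (simp add: NU_graph_def span_subset_perp)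
qed

lemma pair_graph_NU: "pair_graph (NU_graph H)"
  using pair_graph_NU_graph[OF form] r_ge_2 by simp

lemma pverts_NU: "pverts (NU_graph H) = nonisotropic_points H"
  by (simp add: NU_graph_def)

text \<open>The vertex \<open>w\<close> is spanned by \<open>u + c *s v\<close> from
  \<open>third_point_on_line\<close>; \<open>c \<noteq> 0\<close> keeps it apart from
  \<open>x\<close>.\<close>

lemma third_vertex_NU_graph: "third_vertex_property (NU_graph H)"
  unfolding third_vertex_property_def
proof (intro ballI impI, elim conjE)
  fix x y
  assume "x \<in> pverts (NU_graph H)" "y \<in> pverts (NU_graph H)"
    and xy: "x \<noteq> y" "(x, y) \<notin> parcs (NU_graph H)"
  then obtain u v where u: "H u u \<noteq> 0" "x = vec.span {u}" and v: "H v v \<noteq> 0" "y = vec.span {v}"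
    by (auto simp: pverts_NU nonisotropic_points_iff)
  then have "H u v \<noteq> 0" using xy NU_graph_arc_iff by blast
  then obtain c where c: "c \<noteq> 0" "H (u + c *s v) (u + c *s v) \<noteq> 0"
    using third_point_on_line[OF u(1)] by blast
  let ?w = "u + c *s v"
  have uv: "u \<notin> vec.span {v}"
    using span_singleton_eq[of u v] u v xy by (metis zero_left)
  have vu: "v \<notin> vec.span {u}"
    using span_singleton_eq[of v u] u v xy by (metis zero_left)
  have "vec.span {?w} \<noteq> x"
  proof
    assume "vec.span {?w} = x"
    then have "?w \<in> vec.span {u}" using u vec.span_base[of ?w "{?w}"] by simp
    then have "?w - u \<in> vec.span {u}" by (rule vec.span_diff) (simp add: vec.span_base)
    then have "c *s v \<in> vec.span {u}" by (simp only: add_diff_cancel_left')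
    then have "inverse c *s (c *s v) \<in> vec.span {u}" by (rule vec.span_scale)
    then show False using vu c(1) by (simp only: vec.scale_scale left_inverse vec.scale_one simp_thms)
  qed
  moreover have "vec.span {?w} \<noteq> y"
  proof
    assume "vec.span {?w} = y"
    then have "?w \<in> vec.span {v}" using v vec.span_base[of ?w "{?w}"] by simp
    then have "?w - c *s v \<in> vec.span {v}" by (rule vec.span_diff) (simp add: vec.span_base vec.span_scale)
    then show False using uv by (simp only: add_diff_cancel_right' simp_thms)
  qed
  moreover have "(vec.span {?w}, z) \<in> parcs (NU_graph H)"
    if z: "z \<in> pverts (NU_graph H)" "(x, z) \<in> parcs (NU_graph H)" "(y, z) \<in> parcs (NU_graph H)" for z
  proof -
    obtain t where t: "H t t \<noteq> 0" "z = vec.span {t}"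
      using z(1) by (auto simp: pverts_NU nonisotropic_points_iff)
    then have "H u t = 0" "H v t = 0" using z u v NU_graph_arc_iff by auto
    then have "H ?w t = 0" by simp
    then show ?thesis using t c NU_graph_arc_iff by blast
  qed
  moreover have "vec.span {?w} \<in> pverts (NU_graph H)"
    using c unfolding pverts_NU nonisotropic_points_iff by blast
  ultimately show "\<exists>w\<in>pverts (NU_graph H). w \<noteq> x \<and> w \<noteq> y \<and> (\<forall>z\<in>pverts (NU_graph H).
      (x, z) \<in> parcs (NU_graph H) \<and> (y, z) \<in> parcs (NU_graph H) \<longrightarrow> (w, z) \<in> parcs (NU_graph H))"
    by blast
qed

text \<open>The failing pair is \<open>vec.span {u}\<close> and \<open>vec.span {f + u}\<close>.
  Unchanged neighbourhoods confine a third vertex to their line, and one switched vertex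
  \<open>z\<close> then excludes it.\<close>

lemma not_third_vertex_switch:
  assumes n: "CARD('n) \<ge> 6"
    and ef: "H e e = 0" "H f f = 0" "H e f = 1"
    and u: "H u u \<noteq> 0" "H u e = 0" "H u f = 0"
    and v: "H v v \<noteq> 0" "H v e = 0" "H v f = 0" "H v u = 0"
    and L: "L1 = vec.span {e, u}" "L2 = vec.span {e, a *s u + v}" "L1 \<inter> L2 = vec.span {e}"
      "H (a *s u + v) (a *s u + v) \<noteq> 0"
    and C1: "C1 = {x \<in> nonisotropic_points H. x \<subseteq> L1 \<and> \<not> x \<subseteq> L2}"
    and C2: "C2 = {x \<in> nonisotropic_points H. x \<subseteq> L2 \<and> \<not> x \<subseteq> L1}"
  shows "\<not> third_vertex_property (switch (NU_graph H) C1 C2)"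
proof
  let ?G = "NU_graph H" and ?S = "switch (NU_graph H) C1 C2"
  assume third: "third_vertex_property ?S"
  define t where "t = a *s u + v"
  have s: "H f e = 1" "H e u = 0" "H f u = 0" "H e v = 0" "H f v = 0" "H u v = 0"
    using conj_sym[of f e] ef v(2-4)[THEN orth_sym] u(2,3)[THEN orth_sym] by simp_all
  have t: "H t t \<noteq> 0" "H t e = 0" "H e t = 0" using L(4) u v s by (auto simp: t_def)
  have pv: "pverts ?S = nonisotropic_points H" by (simp add: switch_def Let_def pverts_NU)
  \<comment> \<open>The lines meet in an isotropic point, so a non-isotropic point of one is never
    on the other.\<close>
  have not_e: "g \<notin> vec.span {e}" if "H g g \<noteq> 0" for g
    using that ef by (auto simp: vec.span_singleton)
  have C1_iff: "vec.span {g} \<in> C1 \<longleftrightarrow> g \<in> vec.span {e, u}" if "H g g \<noteq> 0" for g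
    using that not_e[OF that] L(1-3) by (auto simp: C1 nonisotropic_points_iff span_singleton_subset)
  have C2_iff: "vec.span {g} \<in> C2 \<longleftrightarrow> g \<in> vec.span {e, t}" if "H g g \<noteq> 0" for g
    using that not_e[OF that] L(1-3) by (auto simp: C2 t_def nonisotropic_points_iff span_singleton_subset)
  have perp_e: "H g e = 0" if "g \<in> vec.span {e, u} \<or> g \<in> vec.span {e, t}" for g
    using that ef u t by (auto simp: span_pair)
  have outside: "vec.span {g} \<in> pverts ?G - (C1 \<union> C2)" if "H g g \<noteq> 0" "H g e \<noteq> 0" for g
    using that perp_e[of g] C1_iff[of g] C2_iff[of g] by (auto simp: pverts_NU nonisotropic_points_iff)
  have unchanged: "(x, vec.span {g}) \<in> parcs ?S \<longleftrightarrow> (x, vec.span {g}) \<in> parcs ?G"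
    if g: "H g g \<noteq> 0" "H g e \<noteq> 0" and x: "x \<in> pverts ?G" for x g
  proof -
    \<comment> \<open>A vector orthogonal to both \<open>d\<close> and \<open>d + e\<close> is
      orthogonal to \<open>e\<close>. Hence \<open>g\<close> misses a point of \<open>C1\<close> and
      a point of \<open>C2\<close>, and neither switching case applies.\<close>
    have not_all: "\<exists>y\<in>C. y \<notin> nbhd ?G (vec.span {g})"
      if "H d d \<noteq> 0" "H d e = 0" "H e d = 0" "vec.span {d} \<in> C" "vec.span {d + e} \<in> C" for d C
    proof (rule ccontr)
      assume "\<not> (\<exists>y\<in>C. y \<notin> nbhd ?G (vec.span {g}))"
      then have "(vec.span {g}, vec.span {d}) \<in> parcs ?G" "(vec.span {g}, vec.span {d + e}) \<in> parcs ?G"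
        using that by (auto simp: nbhd_def)
      then have "H g d = 0" "H g (d + e) = 0"
        using NU_graph_arc_iff[of g d] NU_graph_arc_iff[of g "d + e"] g that ef by auto
      then show False using g by simp
    qed
    have base: "d \<in> vec.span {e, d}" "d + e \<in> vec.span {e, d}" for d
      by (auto intro: vec.span_add vec.span_base)
    have "\<exists>y\<in>C1. y \<notin> nbhd ?G (vec.span {g})"
      by (rule not_all[of u]) (use u s ef C1_iff[of u] C1_iff[of "u + e"] base[of u] in auto)
    moreover have "\<exists>y\<in>C2. y \<notin> nbhd ?G (vec.span {g})"
      by (rule not_all[of t]) (use t ef C2_iff[of t] C2_iff[of "t + e"] base[of t] in auto)
    ultimately have "nbhd ?G (vec.span {g}) \<inter> (C1 \<union> C2) \<noteq> C1"
      "nbhd ?G (vec.span {g}) \<inter> (C1 \<union> C2) \<noteq> C2" by blast+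
    then show ?thesis
      using switch_arc_unchanged[OF pair_graph_NU outside[OF g] _ _ x] by blast
  qed
  define y where "y = f + u"
  have y: "H y y \<noteq> 0" "H y e \<noteq> 0" "H u y \<noteq> 0"
    using ef u s by (auto simp: y_def)
  have uV: "vec.span {u} \<in> pverts ?G" and yV: "vec.span {y} \<in> pverts ?G"
    using u y by (auto simp: pverts_NU nonisotropic_points_iff)
  have uC: "vec.span {u} \<in> C1" using C1_iff[of u] u vec.span_base[of u "{e, u}"] by simp
  have ne: "vec.span {u} \<noteq> vec.span {y}" using uC outside[OF y(1,2)] by auto
  have nonadj: "(vec.span {u}, vec.span {y}) \<notin> parcs ?S"
    using unchanged[OF y(1,2) uV] NU_graph_arc_iff u y by blast
  have "\<forall>x\<in>nonisotropic_points H. \<forall>y\<in>nonisotropic_points H. x \<noteq> y \<and> (x, y) \<notin> parcs ?S \<longrightarrow>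
     (\<exists>w\<in>nonisotropic_points H. w \<noteq> x \<and> w \<noteq> y \<and> (\<forall>z\<in>nonisotropic_points H.
       (x, z) \<in> parcs ?S \<and> (y, z) \<in> parcs ?S \<longrightarrow> (w, z) \<in> parcs ?S))"
    using third by (simp only: third_vertex_property_def pv)
  from this[rule_format, OF uV[unfolded pverts_NU] yV[unfolded pverts_NU]] ne nonadj
  obtain w0 where w0: "w0 \<in> nonisotropic_points H" "w0 \<noteq> vec.span {u}" "w0 \<noteq> vec.span {y}"
    and adj0: "\<forall>z\<in>nonisotropic_points H. (vec.span {u}, z) \<in> parcs ?S \<and> (vec.span {y}, z) \<in> parcs ?S
      \<longrightarrow> (w0, z) \<in> parcs ?S"
    by blast
  then obtain w where w: "H w w \<noteq> 0" "w0 = vec.span {w}" by (auto simp: nonisotropic_points_iff)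
  have adj: "(w0, vec.span {z}) \<in> parcs ?S"
    if "H z z \<noteq> 0" "(vec.span {u}, vec.span {z}) \<in> parcs ?S" "(vec.span {y}, vec.span {z}) \<in> parcs ?S" for z
    using adj0 that nonisotropic_points_iff by blast
  have wV: "w0 \<in> pverts ?G" using w0 by (simp add: pverts_NU)
  have "H w z = 0" if z: "H z z \<noteq> 0" "H z e \<noteq> 0" "H z u = 0" "H z f = 0" for z
  proof -
    have "H u z = 0" "H y z = 0" using z(3,4)[THEN orth_sym] by (simp_all add: y_def)
    then have "(vec.span {u}, vec.span {z}) \<in> parcs ?S" "(vec.span {y}, vec.span {z}) \<in> parcs ?S"
      using unchanged[OF z(1,2) uV] unchanged[OF z(1,2) yV] NU_graph_arc_iff z u y by auto
    then have "(w0, vec.span {z}) \<in> parcs ?G" using adj z unchanged[OF z(1,2) wV] by blast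
    then show ?thesis using w z NU_graph_arc_iff by blast
  qed
  then obtain b c where wbc: "w = b *s f + c *s u"
    using in_line_if_orthogonal[OF ef u(1) s(2,3) v] by blast
  have "b \<noteq> 0"
  proof
    assume "b = 0"
    then have "w \<in> vec.span {u}" by (simp add: wbc vec.span_scale vec.span_base)
    then show False using span_singleton_eq[of w u] w w0 by (metis zero_left)
  qed
  \<comment> \<open>So \<open>w0\<close> lies outside \<open>C1 \<union> C2\<close>, and its
    adjacency to other outside vertices is that of the original graph.\<close>
  then have we: "H w e \<noteq> 0" using u s by (simp add: wbc)
  obtain z where z: "H z z \<noteq> 0" "H z e = 0" "H z t = 0" "H z y = 0" "H z u \<noteq> 0"
    "z \<notin> vec.span {e, u}"
    using switched_witness[OF n ef u v] unfolding t_def y_def by blast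
  have z2: "z \<notin> vec.span {e, t}"
  proof
    assume "z \<in> vec.span {e, t}"
    then have "H z z = 0" using z(2,3) by (auto simp: span_pair)
    then show False using z(1) by simp
  qed
  have zD: "vec.span {z} \<in> pverts ?G - (C1 \<union> C2)"
    using z z2 C1_iff C2_iff by (auto simp: pverts_NU nonisotropic_points_iff)
  \<comment> \<open>\<open>z\<close> is orthogonal to all of \<open>L2\<close>, whereas a
    non-isotropic vector of \<open>L1\<close> has a nonzero \<open>u\<close>-coefficient and
    \<open>H z u \<noteq> 0\<close>.\<close>
  have "nbhd ?G (vec.span {z}) \<inter> (C1 \<union> C2) = C2"
  proof -
    have 1: "q \<notin> nbhd ?G (vec.span {z})" if q1: "q \<in> C1" for q
    proof
      assume q: "q \<in> nbhd ?G (vec.span {z})"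
      obtain g where g: "H g g \<noteq> 0" "q = vec.span {g}"
        using q1 by (auto simp: C1 nonisotropic_points_iff)
      then obtain j k where jk: "g = j *s e + k *s u" using C1_iff q1 by (auto simp: span_pair)
      then have "k \<noteq> 0" using g ef by auto
      moreover have "H z g = 0" using q g z NU_graph_arc_iff by (auto simp: nbhd_def)
      ultimately show False using z by (simp add: jk)
    qed
    have 2: "q \<in> nbhd ?G (vec.span {z})" if q2: "q \<in> C2" for q
    proof -
      obtain g where g: "H g g \<noteq> 0" "q = vec.span {g}"
        using q2 by (auto simp: C2 nonisotropic_points_iff)
      then obtain j k where jk: "g = j *s e + k *s t" using C2_iff q2 by (auto simp: span_pair)
      then have "H z g = 0" using z by simp
      then show ?thesis using g z NU_graph_arc_iff by (auto simp: nbhd_def)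
    qed
    show ?thesis using 1 2 by blast
  qed
  then have "(vec.span {u}, vec.span {z}) \<in> parcs ?S"
    using switch_arc_switched[of "vec.span {z}" ?G] zD uC by blast
  moreover have "(vec.span {y}, vec.span {z}) \<in> parcs ?S"
    using switch_arc_outside[OF outside[OF y(1,2)] zD] NU_graph_arc_iff y z orth_sym by blast
  ultimately have "(w0, vec.span {z}) \<in> parcs ?S" using adj z by blast
  then have "H w z = 0"
    using switch_arc_outside[OF outside[OF w(1) we] zD] NU_graph_arc_iff w z by blast
  moreover have "H y z = 0" using z orth_sym by blast
  \<comment> \<open>Pairing with \<open>z\<close> kills \<open>w\<close> and \<open>y\<close> but
    not \<open>u\<close>, so \<open>c = b\<close> and \<open>w0\<close> would be the point of
    \<open>y\<close>.\<close>
  moreover have "w = b *s y + (c - b) *s u"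
    by (simp add: wbc y_def vec.scale_right_distrib vec.scale_left_diff_distrib)
  ultimately have "(c - b) * H u z = 0" by simp
  moreover have "H u z \<noteq> 0" using z orth_sym by blast
  ultimately have "w = b *s y" using \<open>w = b *s y + (c - b) *s u\<close> by simp
  then have "w \<in> vec.span {y}" by (simp add: vec.span_scale vec.span_base)
  then show False using span_singleton_eq[of w y] w w0 by (metis zero_left)
qed

section \<open>Coordinates for the two lines and the conclusion\<close>

text \<open>The radical of \<open>L\<close> is spanned by \<open>e\<close>, so any vector of
  \<open>L\<close> outside it has nonzero norm; otherwise it would lie in the radical too.\<close>

lemma tangent_line_basis:
  assumes L: "vec.subspace L" "vec.dim L = 2" and e: "e \<noteq> 0" "L \<inter> perp H L = vec.span {e}"
  obtains u where "L = vec.span {e, u}" "H u u \<noteq> 0" "H e u = 0" "u \<notin> vec.span {e}"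
proof -
  have eL: "e \<in> L" "\<And>x. x \<in> L \<Longrightarrow> H e x = 0"
    using e(2) vec.span_base[of e "{e}"] by (auto simp: perp_def)
  have "\<not> L \<subseteq> vec.span {e}"
  proof
    assume "L \<subseteq> vec.span {e}"
    then have "vec.dim L \<le> card {e}" by (intro vec.dim_le_card) auto
    then show False using L by simp
  qed
  then obtain u where u: "u \<in> L" "u \<notin> vec.span {e}" by blast
  have ne: "u \<noteq> e" using u vec.span_base[of e "{e}"] by auto
  have "vec.independent {e, u}"
    using u e ne by (simp add: insert_commute[of e] vec.independent_insert vec.dependent_single)
  then have "L \<subseteq> vec.span {e, u}"
    using eL u L ne by (intro vec.card_ge_dim_independent) auto
  moreover have "vec.span {e, u} \<subseteq> L"
    using eL u L by (intro vec.span_minimal) auto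
  ultimately have Leq: "L = vec.span {e, u}" by blast
  have "H u u \<noteq> 0"
  proof
    assume uu: "H u u = 0"
    have ue: "H u e = 0" using eL u orth_sym by blast
    have "u \<in> perp H L" using uu ue by (auto simp: Leq perp_def span_pair)
    then show False using u e by blast
  qed
  then show ?thesis using that Leq eL u by blast
qed

end

theorem theorem9:
  fixes H :: "'a::{field,finite} ^ 'n \<Rightarrow> 'a ^ 'n \<Rightarrow> 'a"
    and r :: nat
    and L1 L2 P p :: "('a ^ 'n) set"
    and C1 C2 :: "('a ^ 'n) set set"
  assumes q_square: "CARD('a) = r\<^sup>2"
    and n_ge: "CARD('n) \<ge> 6"
    and form: "hermitian_form r H" "nondegenerate H"
    and L1: "vec.subspace L1" "vec.dim L1 = 2" "\<not> L1 \<subseteq> perp H L1"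
    and L2: "vec.subspace L2" "vec.dim L2 = 2" "\<not> L2 \<subseteq> perp H L2"
    and p: "p = L1 \<inter> L2" "is_point p" "p = L1 \<inter> perp H L1" "p = L2 \<inter> perp H L2"
    and P: "P = {u + v | u v. u \<in> L1 \<and> v \<in> L2}"
    and Pp: "quotient_nondegenerate H P p"
    and C1: "C1 = {x \<in> nonisotropic_points H. x \<subseteq> L1 \<and> \<not> x \<subseteq> L2}"
    and C2: "C2 = {x \<in> nonisotropic_points H. x \<subseteq> L2 \<and> \<not> x \<subseteq> L1}"
  shows "\<not> digraph_iso (with_proj (switch (NU_graph H) C1 C2)) (with_proj (NU_graph H))"
proof -
  interpret hermitian_space H r
    by unfold_locales (fact q_square form)+
  obtain e where e: "e \<noteq> 0" "p = vec.span {e}" using p(2) by (auto simp: is_point_iff)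
  obtain u where u: "L1 = vec.span {e, u}" "H u u \<noteq> 0" "H e u = 0" "u \<notin> vec.span {e}"
    using tangent_line_basis[OF L1(1,2) e(1)] p(3) e(2) by metis
  obtain t where t: "L2 = vec.span {e, t}" "H t t \<noteq> 0" "H e t = 0" "t \<notin> vec.span {e}"
    using tangent_line_basis[OF L2(1,2) e(1)] p(4) e(2) by metis
  have ee: "H e e = 0"
    using p(3) e(2) vec.span_base[of e "{e}"] by (auto simp: perp_def)
  have ue: "H u e = 0" and te: "H t e = 0" using u t orth_sym by blast+
  \<comment> \<open>This choice makes \<open>v\<close> the component of \<open>t\<close> orthogonal
    to \<open>u\<close>.\<close>
  define a where "a = H t u / H u u"
  define v where "v = t - a *s u"
  have tav: "t = a *s u + v" by (simp add: v_def)
  have vu: "H v u = 0" using u by (simp add: v_def a_def)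
  have ve: "H v e = 0" using ue te by (simp add: v_def)
  have mem: "e \<in> L1" "e \<in> L2" "u \<in> L1" "t \<in> L2"
    unfolding u(1) t(1) by (auto intro: vec.span_base)
  \<comment> \<open>Here the nondegeneracy of \<open>P/p\<close> enters. \<open>P\<close> is spanned
    by \<open>e\<close>, \<open>u\<close>, \<open>v\<close>, so an isotropic \<open>v\<close> would
    lie in the radical of \<open>P\<close>, hence in \<open>p\<close>; then \<open>t\<close> would
    lie in \<open>L1 \<inter> L2\<close>.\<close>
  have vv: "H v v \<noteq> 0"
  proof
    assume vv: "H v v = 0"
    have subP: "vec.subspace P" unfolding P by (rule vec.subspace_sums[OF L1(1) L2(1)])
    have subp: "vec.subspace p" using p(2) by (simp add: is_point_def)
    have P_form: "\<exists>i j k. x = i *s e + j *s u + k *s v" if "x \<in> P" for x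
    proof -
      obtain x1 x2 where "x1 \<in> L1" "x2 \<in> L2" "x = x1 + x2" using \<open>x \<in> P\<close> unfolding P by blast
      moreover obtain i j where "x1 = i *s e + j *s u" using \<open>x1 \<in> L1\<close> unfolding u(1) span_pair by blast
      moreover obtain k l where "x2 = k *s e + l *s t" using \<open>x2 \<in> L2\<close> unfolding t(1) span_pair by blast
      ultimately have "x = (i *s e + j *s u) + (k *s e + l *s t)" by simp
      then have "x = (i + k) *s e + (j + l * a) *s u + l *s v"
        by (simp add: tav vec.scale_right_distrib vec.scale_left_distrib algebra_simps)
      then show ?thesis by blast
    qed
    have ev: "H e v = 0" using ve by (rule orth_sym)
    have "H e x = 0" if "x \<in> P" for x
      using P_form[OF that] ee u ev by auto
    then have pP: "p \<subseteq> perp H P" by (auto simp: e(2) perp_def vec.span_singleton)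
    have p_sub: "p \<subseteq> P"
    proof
      fix x assume "x \<in> p"
      then have "x \<in> L1" using p(1) by blast
      moreover have "0 \<in> L2" using L2(1) by (rule vec.subspace_0)
      ultimately show "x \<in> P" unfolding P by force
    qed
    have "v = (- a) *s u + t" by (simp add: tav)
    moreover have "(- a) *s u \<in> L1" using mem L1(1) by (intro vec.subspace_scale)
    ultimately have vP: "v \<in> P" unfolding P using mem by blast
    have Hv: "H v x = 0" if "x \<in> P" for x
      using P_form[OF that] ve vu vv by auto
    have r0: "r > 0" using r_ge_2 by simp
    have "(+) v ` p = p"
      using Pp vP unfolding quotient_nondegenerate_def quotient_space_eq[OF subP subp p_sub]
      by (auto simp: induced_form_eq[OF form(1) r0 subp pP _ _ subP p_sub] Hv)
    moreover have "0 \<in> p" using subp by (rule vec.subspace_0)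
    ultimately have "v \<in> p" by force
    then have "v + a *s u \<in> L1" using p(1) mem L1(1) by (intro vec.subspace_add vec.subspace_scale) auto
    then have "t \<in> L1 \<inter> L2" using mem by (simp add: tav add.commute)
    then show False using t p e by simp
  qed
  obtain f where f: "H f f = 0" "H e f = 1" "H f u = 0" "H f v = 0"
    using hyperbolic_partner[OF e(1) ee u(3) orth_sym[OF ve] orth_sym[OF vu] u(2) vv] by blast
  have S: "\<not> third_vertex_property (switch (NU_graph H) C1 C2)"
    by (rule not_third_vertex_switch[OF n_ge ee f(1,2) u(2) ue orth_sym[OF f(3)] vv ve orth_sym[OF f(4)] vu
        u(1) _ _ _ C1 C2]) (use t p e tav in auto)
  have "C1 \<subseteq> pverts (NU_graph H)" "C2 \<subseteq> pverts (NU_graph H)"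
    by (auto simp: C1 C2 pverts_NU)
  then have "pair_graph (switch (NU_graph H) C1 C2)"
    by (rule pair_graph_switch[OF pair_graph_NU])
  then show ?thesis
    using S third_vertex_NU_graph third_vertex_property_iso pair_graph_NU by blast
qed

end
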